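(* Let $p\ge2$ be an integer. For every $g\in F(p)$ there is exactly one word over the alphabet $\{x_0^{\pm1},x_1^{\pm1},\ldots,x_{p-1}^{\pm1}\}$ that represents $g$ and has no forbidden subwords (i.e. belongs to $\mathcal N_{\mathrm{fin}}$). This gives a regular set of normal forms for the group $F(p)$; that is, $\mathcal N_{\mathrm{fin}}$ is a regular language.
   Context: For an integer $p\ge2$, the generalized Thompson group $F(p)$ is the group given by the presentation $\langle x_i\ (i\ge0)\mid x_jx_i=x_ix_{j+p-1}\ (0\le i<j)\rangle$. It is generated by $x_0,x_1,\dots,x_{p-1}$. Forbidden subwords are the following words over $\{x_0^{\pm1},\ldots,x_{p-1}^{\pm1}\}$, where $\varepsilon=\pm1$ is arbitrary: (1) $x_i^\varepsilon x_i^{-\varepsilon}$ with $0\le i\le p-1$; (2) $x_\alpha^\varepsilon x_0^kx_\beta$ with $k\ge0$, $1\le\beta<\alpha\le p-1$; (3) $x_\alpha^\varepsilon x_0^{k+1}x_\beta^{-1}$ with $k\ge0$, $1\le\beta<\alpha\le p-1$; (4) $x_\alpha^\varepsilon x_0^{k+1}x_\beta$ with $k\ge0$, $1\le\alpha\le\beta\le p-1$; (5) $x_\alpha^\varepsilon x_0^{k+2}x_\beta^{-1}$ with $k\ge0$, $1\le\alpha\le\beta\le p-1$. $\mathcal N_{\mathrm{fin}}$ denotes the set of all words over $\{x_0^{\pm1},x_1^{\pm1},\ldots,x_{p-1}^{\pm1}\}$ having no (contiguous) subword of one of these forms. *)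

theory Defs
  imports "HOL-Algebra.Group" "HOL-Library.Sublist"
begin

text \<open>Group words: the letter \<open>(x, True)\<close> stands for \<open>x\<close> and \<open>(x, False)\<close> for its formal inverse.\<close>

type_synonym 'a gword = "('a \<times> bool) list"

text \<open>The group presented by generators all of \<open>'a\<close> and relations \<open>u = v\<close> for \<open>(u, v) \<in> R\<close>:
  words modulo the least congruence for concatenation that contains \<open>R\<close> and free cancellation.\<close>

inductive_set pres_cong :: "('a gword \<times> 'a gword) set \<Rightarrow> ('a gword \<times> 'a gword) set"
  for R :: "('a gword \<times> 'a gword) set" where
  rel: "(u, v) \<in> R \<Longrightarrow> (u, v) \<in> pres_cong R"
| cancel: "([(x, e), (x, \<not> e)], []) \<in> pres_cong R"
| refl: "(u, u) \<in> pres_cong R"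
| sym: "(u, v) \<in> pres_cong R \<Longrightarrow> (v, u) \<in> pres_cong R"
| trans: "(u, v) \<in> pres_cong R \<Longrightarrow> (v, w) \<in> pres_cong R \<Longrightarrow> (u, w) \<in> pres_cong R"
| append: "(u, u') \<in> pres_cong R \<Longrightarrow> (v, v') \<in> pres_cong R \<Longrightarrow> (u @ v, u' @ v') \<in> pres_cong R"

definition presented_group :: "('a gword \<times> 'a gword) set \<Rightarrow> 'a gword set monoid" where
  "presented_group R =
    \<lparr> carrier = UNIV // pres_cong R,
      mult = (\<lambda>A B. \<Union>u\<in>A. \<Union>v\<in>B. pres_cong R `` {u @ v}),
      one = pres_cong R `` {[]} \<rparr>"

definition pres_gen :: "('a gword \<times> 'a gword) set \<Rightarrow> 'a \<Rightarrow> 'a gword set" where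
  "pres_gen R x = pres_cong R `` {[(x, True)]}"

definition word_value :: "('g, 'm) monoid_scheme \<Rightarrow> ('a \<Rightarrow> 'g) \<Rightarrow> 'a gword \<Rightarrow> 'g" where
  "word_value G f w =
    foldr (\<lambda>(x, e) g. (if e then f x else inv\<^bsub>G\<^esub> (f x)) \<otimes>\<^bsub>G\<^esub> g) w \<one>\<^bsub>G\<^esub>"

lemma equiv_pres_cong: "equiv UNIV (pres_cong R)"
proof (rule equivI)
  show "refl (pres_cong R)" by (rule refl_onI) (rule pres_cong.refl)
  show "sym (pres_cong R)" by (rule symI) (rule pres_cong.sym)
  show "trans (pres_cong R)" by (rule transI) (rule pres_cong.trans)
qed auto

lemma presented_group_mult:
  "pres_cong R `` {u} \<otimes>\<^bsub>presented_group R\<^esub> pres_cong R `` {v} = pres_cong R `` {u @ v}"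
proof -
  have "pres_cong R `` {u' @ v'} = pres_cong R `` {u @ v}"
    if "(u, u') \<in> pres_cong R" "(v, v') \<in> pres_cong R" for u' v'
    by (rule equiv_class_eq[OF equiv_pres_cong pres_cong.sym[OF pres_cong.append[OF that]]])
  moreover have "(u, u) \<in> pres_cong R" "(v, v) \<in> pres_cong R"
    by (rule pres_cong.refl)+
  ultimately have "(\<Union>u'\<in>pres_cong R `` {u}. \<Union>v'\<in>pres_cong R `` {v}. pres_cong R `` {u' @ v'})
      = pres_cong R `` {u @ v}"
    by blast
  then show ?thesis
    by (simp only: presented_group_def monoid.simps)
qed

lemma inverse_word_cong: "(map (\<lambda>(x, e). (x, \<not> e)) (rev w) @ w, []) \<in> pres_cong R"
proof (induction w)
  case Nil
  then show ?case by (simp add: pres_cong.refl)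
next
  case (Cons a w)
  obtain x e where a: "a = (x, e)" by (cases a)
  let ?v = "map (\<lambda>(x, e). (x, \<not> e)) (rev w)"
  have "([(x, \<not> e), (x, e)], []) \<in> pres_cong R"
    using pres_cong.cancel[of x "\<not> e" R] by simp
  then have "(?v @ [(x, \<not> e), (x, e)] @ w, ?v @ [] @ w) \<in> pres_cong R"
    by (intro pres_cong.append pres_cong.refl)
  then have "(?v @ [(x, \<not> e), (x, e)] @ w, []) \<in> pres_cong R"
    by (rule pres_cong.trans) (simp only: append_Nil Cons.IH)
  then show ?case by (simp add: a)
qed

lemma group_presented_group: "group (presented_group R)"
proof (rule groupI)
  note car = presented_group_def quotient_def
  let ?G = "presented_group R"
  have cls: "\<exists>u. A = pres_cong R `` {u}" if "A \<in> carrier ?G" for A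
    using that by (auto simp: car)
  have in_car: "pres_cong R `` {u} \<in> carrier ?G" for u
    by (auto simp: car)
  have one: "\<one>\<^bsub>?G\<^esub> = pres_cong R `` {[]}"
    by (simp add: presented_group_def)
  show "\<one>\<^bsub>?G\<^esub> \<in> carrier ?G"
    by (simp add: one in_car)
  fix A assume "A \<in> carrier ?G"
  then obtain u where A: "A = pres_cong R `` {u}" using cls by blast
  show "\<one>\<^bsub>?G\<^esub> \<otimes>\<^bsub>?G\<^esub> A = A"
    by (simp add: A one presented_group_mult)
  have "pres_cong R `` {map (\<lambda>(x, e). (x, \<not> e)) (rev u)} \<otimes>\<^bsub>?G\<^esub> A = \<one>\<^bsub>?G\<^esub>"
    unfolding A one presented_group_mult
    by (rule equiv_class_eq[OF equiv_pres_cong inverse_word_cong])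
  then show "\<exists>B\<in>carrier ?G. B \<otimes>\<^bsub>?G\<^esub> A = \<one>\<^bsub>?G\<^esub>"
    using in_car by blast
  fix B assume "B \<in> carrier ?G"
  then obtain v where B: "B = pres_cong R `` {v}" using cls by blast
  show "A \<otimes>\<^bsub>?G\<^esub> B \<in> carrier ?G"
    by (simp add: A B presented_group_mult in_car)
  fix C assume "C \<in> carrier ?G"
  then obtain w where C: "C = pres_cong R `` {w}" using cls by blast
  show "A \<otimes>\<^bsub>?G\<^esub> B \<otimes>\<^bsub>?G\<^esub> C = A \<otimes>\<^bsub>?G\<^esub> (B \<otimes>\<^bsub>?G\<^esub> C)"
    by (simp add: A B C presented_group_mult)
qed

lemma word_value_presented_group:
  "word_value (presented_group R) (pres_gen R) w = pres_cong R `` {w}"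
proof (induction w)
  case Nil
  then show ?case by (simp add: word_value_def presented_group_def)
next
  case (Cons a w)
  let ?G = "presented_group R"
  interpret group ?G by (rule group_presented_group)
  obtain x e where a: "a = (x, e)" by (cases a)
  have in_car: "pres_cong R `` {u} \<in> carrier ?G" for u
    by (auto simp: presented_group_def quotient_def)
  have "pres_cong R `` {[(x, False)]} \<otimes>\<^bsub>?G\<^esub> pres_gen R x = \<one>\<^bsub>?G\<^esub>"
    unfolding pres_gen_def presented_group_mult
    using equiv_class_eq[OF equiv_pres_cong pres_cong.cancel[of x False R]]
    by (simp add: presented_group_def)
  then have "inv\<^bsub>?G\<^esub> (pres_gen R x) = pres_cong R `` {[(x, False)]}"
    using in_car by (intro inv_equality) (auto simp: pres_gen_def)
  then have letter: "(if e then pres_gen R x else inv\<^bsub>?G\<^esub> (pres_gen R x)) = pres_cong R `` {[a]}"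
    by (cases e) (simp_all add: a pres_gen_def)
  have "word_value ?G (pres_gen R) (a # w) =
      (if e then pres_gen R x else inv\<^bsub>?G\<^esub> (pres_gen R x)) \<otimes>\<^bsub>?G\<^esub> word_value ?G (pres_gen R) w"
    by (simp only: word_value_def a foldr.simps o_apply prod.case)
  also have "\<dots> = pres_cong R `` {[a] @ w}"
    unfolding letter Cons.IH by (rule presented_group_mult)
  finally show ?case by simp
qed

definition thompson_rels :: "nat \<Rightarrow> (nat gword \<times> nat gword) set" where
  "thompson_rels p =
    {([(j, True), (i, True)], [(i, True), (j + p - 1, True)]) | i j. i < j}"

abbreviation thompson_F :: "nat \<Rightarrow> nat gword set monoid" where
  "thompson_F p \<equiv> presented_group (thompson_rels p)"

definition represents :: "nat \<Rightarrow> nat gword \<Rightarrow> nat gword set \<Rightarrow> bool" where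
  "represents p w g \<longleftrightarrow> word_value (thompson_F p) (pres_gen (thompson_rels p)) w = g"

definition alphabet :: "nat \<Rightarrow> (nat \<times> bool) set" where
  "alphabet p = {0..p - 1} \<times> UNIV"

text \<open>The \<open>bool\<close> component \<open>e\<close> encodes the exponent \<open>\<epsilon> = \<plusminus>1\<close>.\<close>

definition forbidden :: "nat \<Rightarrow> nat gword set" where
  "forbidden p =
    {[(i, e), (i, \<not> e)] | i e. i \<le> p - 1}
  \<union> {[(a, e)] @ replicate k (0, True) @ [(b, True)] | a b e k. 1 \<le> b \<and> b < a \<and> a \<le> p - 1}
  \<union> {[(a, e)] @ replicate (k + 1) (0, True) @ [(b, False)] | a b e k. 1 \<le> b \<and> b < a \<and> a \<le> p - 1}
  \<union> {[(a, e)] @ replicate (k + 1) (0, True) @ [(b, True)] | a b e k. 1 \<le> a \<and> a \<le> b \<and> b \<le> p - 1}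
  \<union> {[(a, e)] @ replicate (k + 2) (0, True) @ [(b, False)] | a b e k. 1 \<le> a \<and> a \<le> b \<and> b \<le> p - 1}"

definition N_fin :: "nat \<Rightarrow> nat gword set" where
  "N_fin p = {w \<in> lists (alphabet p). \<not> (\<exists>f \<in> forbidden p. sublist f w)}"

text \<open>Regularity means recognizability by a complete deterministic finite automaton; taking states
  in \<open>nat\<close> is no restriction, as the state set is finite.\<close>

definition regular_language :: "'a set \<Rightarrow> 'a list set \<Rightarrow> bool" where
  "regular_language A L \<longleftrightarrow> finite A \<and> L \<subseteq> lists A \<and>
    (\<exists>(Q :: nat set) q0 F \<delta>. finite Q \<and> q0 \<in> Q \<and> F \<subseteq> Q \<and>
      (\<forall>q\<in>Q. \<forall>a\<in>A. \<delta> q a \<in> Q) \<and>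
      (\<forall>w\<in>lists A. w \<in> L \<longleftrightarrow> foldl \<delta> q0 w \<in> F))"

end

theory Submission
  imports Defs "HOL-Library.Countable"
begin

text \<open>Write \<open>q = p - 1\<close>. Since \<open>x\<^sub>j x\<^sub>0 = x\<^sub>0 x\<^bsub>j+q\<^esub>\<close> for \<open>j \<ge> 1\<close>, there are elements \<open>y\<^sub>m\<close> for
  all integers \<open>m\<close> with \<open>y\<^sub>m = x\<^sub>0\<^sup>n x\<^bsub>m+nq\<^esub> x\<^sub>0\<^sup>-\<^sup>n\<close> whenever \<open>m + nq \<ge> 1\<close>, and they satisfy
  \<open>y\<^sub>m y\<^sub>i = y\<^sub>i y\<^bsub>m+q\<^esub>\<close> for all integers \<open>i < m\<close>. Moving all powers of \<open>x\<^sub>0\<close> to the right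
  turns a word over \<open>x\<^sub>0, \<dots>, x\<^sub>q\<close> into a word in the letters \<open>y\<^sub>m\<close> and their inverses,
  followed by a power of \<open>x\<^sub>0\<close>. Under this translation the forbidden subwords become
  conditions on two adjacent letters: \<open>y\<^sub>m\<^sup>\<plusminus> y\<^sub>i\<close> with \<open>i < m\<close>, \<open>y\<^sub>m\<^sup>\<plusminus> y\<^sub>i\<^sup>-\<^sup>1\<close> with \<open>i + q <
  m\<close>, and cancelling pairs. Words without such pairs are normal forms: multiplying such a word
  by a letter from the left and pushing the letter to the right as long as a forbidden pair
  occurs gives such a word again, and this defines an action of the group on normal words (van
  der Waerden's trick). Forbidden subwords can be detected by remembering the last letter
  different from \<open>x\<^sub>0\<close> and the exponent of \<open>x\<^sub>0\<close> since then, which may be truncated to \<open>{-1,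
  0, 1, 2}\<close>.\<close>

section \<open>Words in the conjugates of the generators\<close>

locale generalized_thompson =
  fixes p :: nat
  assumes p_ge_2: "p \<ge> 2"
begin

definition q :: int where "q = int p - 1"

lemma q_pos: "q \<ge> 1"
  using p_ge_2 by (simp add: q_def)

section \<open>Admissible pairs and pushing a letter into a normal word\<close>

abbreviation jump :: "bool \<Rightarrow> int" where
  "jump d \<equiv> (if d then q else - q)"

text \<open>The letter \<open>(m, True)\<close> stands for \<open>y\<^sub>m\<close>.\<close>

fun admissible :: "int \<times> bool \<Rightarrow> int \<times> bool \<Rightarrow> bool" where
  "admissible (m, e) (i, d) \<longleftrightarrow> m \<le> i + (if d then 0 else q) \<and> \<not> (m = i \<and> d \<noteq> e)"

abbreviation normal :: "int gword \<Rightarrow> bool" where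
  "normal \<equiv> successively admissible"

text \<open>The moving letter changes its index by q or -q whatever its exponent \<open>e\<close>
  is, since the relations describe conjugation by y_i.\<close>

fun push :: "int \<times> bool \<Rightarrow> int gword \<Rightarrow> int gword" where
  "push (m, e) [] = [(m, e)]"
| "push (m, e) ((i, d) # v) =
    (if m = i \<and> d \<noteq> e then v
     else if admissible (m, e) (i, d) then (m, e) # (i, d) # v
     else (i, d) # push (m + jump d, e) v)"

lemma push_normal_Cons: "normal (x # v) \<Longrightarrow> push x v = x # v"
  by (cases x; cases v) auto

lemma normal_ConsD: "normal (x # v) \<Longrightarrow> normal v"
  by (cases v) auto

lemma push_ok: "admissible (m, e) (i, d) \<Longrightarrow> push (m, e) ((i, d) # v) = (m, e) # (i, d) # v"
  by simp

lemma push_swap: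
  "\<not> admissible (m, e) (i, d) \<Longrightarrow> \<not> (m = i \<and> d \<noteq> e)
    \<Longrightarrow> push (m, e) ((i, d) # v) = (i, d) # push (m + jump d, e) v"
  by (auto simp del: admissible.simps)

lemma admissible_cases [case_names cancel admissible swap]:
  obtains "m = i" "e = (\<not> d)" | "admissible (m, e) (i, d)"
    | "\<not> admissible (m, e) (i, d)" "\<not> (m = i \<and> d \<noteq> e)"
  by blast

lemma swap_less:
  "\<not> admissible (m, e) (i, d) \<Longrightarrow> \<not> (m = i \<and> d \<noteq> e) \<Longrightarrow> i + (if d then 0 else q) < m"
  by (cases d) auto

text \<open>Only the junction after \<open>(i, d)\<close> is at stake. The next letter is the moved
  one, the old successor of \<open>(i, d)\<close>, or, if that successor has been cancelled, the
  letter behind it.\<close>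

lemma normal_swap:
  assumes "normal ((i, d) # v)" "\<not> admissible (m, e) (i, d)" "\<not> (m = i \<and> d \<noteq> e)"
    and "normal (push (m + jump d, e) v)"
  shows "normal ((i, d) # push (m + jump d, e) v)"
proof -
  have less: "i + (if d then 0 else q) < m"
    using assms(2,3) by (rule swap_less)
  \<comment> \<open>In both cases \<open>i < m + jump d\<close>, so any letter with that index may
    follow.\<close>
  then have head: "admissible (i, d) (m + jump d, e)"
    using q_pos by (cases d; cases e; simp)
  show ?thesis
  proof (cases v)
    case Nil
    then show ?thesis using head by simp
  next
    case (Cons x v')
    obtain j b where x: "x = (j, b)" by (cases x)
    have id: "admissible (i, d) (j, b)" using assms(1) Cons x by (simp del: admissible.simps)
    show ?thesis
    proof (cases "m + jump d" j e b rule: admissible_cases)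
      case cancel
      show ?thesis
      proof (cases v')
        case (Cons y v'')
        obtain n a where y: "y = (n, a)" by (cases y)
        have jb: "admissible (j, b) (n, a)" using assms(1) \<open>v = x # v'\<close> Cons x y by (simp del: admissible.simps)
        \<comment> \<open>The bound on \<open>n\<close> is inherited because
          \<open>j = m + jump d\<close> exceeds \<open>i\<close>. The new pair does not cancel: if
          \<open>d\<close> holds, then \<open>j > i + q\<close> forces \<open>n > i\<close>;
          otherwise \<open>a\<close> would have to be \<open>True\<close>, and then
          \<open>i < j \<le> n\<close>.\<close>
        then have "admissible (i, d) (n, a)"
          using less cancel(1)[symmetric] q_pos by (cases d; cases a; simp)
        then show ?thesis using cancel assms(1) \<open>v = x # v'\<close> Cons x y by (simp del: admissible.simps)
      qed (use cancel Cons x in simp)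
    next
      case admissible
      then show ?thesis using head assms(4) Cons x by (simp only: push_ok successively.simps)
    next
      case swap
      show ?thesis
        using id assms(4)[unfolded Cons x push_swap[OF swap]]
        unfolding Cons x push_swap[OF swap] by simp
    qed
  qed
qed

lemma normal_push: "normal v \<Longrightarrow> normal (push x v)"
proof (induction x v rule: push.induct)
  case (2 m e i d v)
  show ?case
  proof (cases m i e d rule: admissible_cases)
    case cancel
    then show ?thesis using normal_ConsD[OF "2.prems"] by simp
  next
    case admissible
    then show ?thesis using "2.prems" by (simp only: push_ok successively.simps)
  next
    case swap
    show ?thesis
      unfolding push_swap[OF swap]
      by (rule normal_swap[OF "2.prems" swap "2.IH"[OF swap(2,1) normal_ConsD[OF "2.prems"]]])
  qed
qed simp

text \<open>Swapping is decided by indices alone, so a letter and its inverse pass the same letters.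
  Where the first one stops, the second one either cancels it or restores the letter that it has
  cancelled.\<close>

lemma push_cancel: "normal v \<Longrightarrow> push (m, \<not> e) (push (m, e) v) = v"
proof (induction v arbitrary: m)
  case (Cons x v)
  obtain i d where x: "x = (i, d)" by (cases x)
  note prems = Cons.prems[unfolded x]
  show ?case
    unfolding x
  proof (cases m i e d rule: admissible_cases)
    case cancel
    then show "push (m, \<not> e) (push (m, e) ((i, d) # v)) = (i, d) # v"
      using push_normal_Cons[OF prems] by simp
  next
    case admissible
    then show "push (m, \<not> e) (push (m, e) ((i, d) # v)) = (i, d) # v"
      by (simp only: push_ok) simp
  next
    case swap
    have swap': "\<not> admissible (m, \<not> e) (i, d)" "\<not> (m = i \<and> d \<noteq> (\<not> e))"
      using swap_less[OF swap] q_pos by (cases d; simp)+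
    show "push (m, \<not> e) (push (m, e) ((i, d) # v)) = (i, d) # v"
      by (simp only: push_swap[OF swap] push_swap[OF swap'] Cons.IH[OF normal_ConsD[OF prems]])
  qed
qed simp

text \<open>Compare y_i with the first letter. If y_i passes it, so do y_m and y_{m+q}, whose
  indices are larger. If y_i cancels it, y_{m+q} passes it and becomes y_m. If y_i stays in front,
  y_m passes y_i and becomes y_{m+q}.\<close>

lemma push_commute:
  assumes "normal v" "i < m"
  shows "push (m, True) (push (i, True) v) = push (i, True) (push (m + q, True) v)"
  using assms
proof (induction v arbitrary: i m)
  case Nil
  then show ?case using q_pos by simp
next
  case (Cons x v)
  obtain j d where x: "x = (j, d)" by (cases x)
  note prems = Cons.prems[unfolded x]
  show ?case
    unfolding x
  proof (cases i j True d rule: admissible_cases)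
    case cancel
    then have "\<not> admissible (m + q, True) (j, False)" using prems q_pos by simp
    then show "push (m, True) (push (i, True) ((j, d) # v))
        = push (i, True) (push (m + q, True) ((j, d) # v))"
      using cancel prems q_pos push_swap[of "m + q" True j False v] by (simp del: admissible.simps)
  next
    case admissible
    then have n: "normal ((i, True) # (j, d) # v)" using prems by (simp del: admissible.simps)
    have "\<not> admissible (m, True) (i, True)" using prems by simp
    then have *: "push (m, True) (push (i, True) ((j, d) # v)) = (i, True) # push (m + q, True) ((j, d) # v)"
      by (subst push_normal_Cons[OF n]) (subst push_swap, simp_all del: admissible.simps push.simps)
    \<comment> \<open>By normality of the left side, y_i on the right side is merely
      prepended.\<close>
    have "normal (push (m, True) (push (i, True) ((j, d) # v)))"
      by (intro normal_push prems)
    then show "push (m, True) (push (i, True) ((j, d) # v))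
        = push (i, True) (push (m + q, True) ((j, d) # v))"
      using * by (simp only: push_normal_Cons)
  next
    case swap
    have 1: "\<not> admissible (m, True) (j, d)" "\<not> (m = j \<and> d \<noteq> True)"
      "\<not> admissible (m + q, True) (j, d)" "\<not> (m + q = j \<and> d \<noteq> True)"
      using swap_less[OF swap] prems q_pos by (cases d; simp)+
    have "push (m + jump d, True) (push (i + jump d, True) v)
        = push (i + jump d, True) (push (m + q + jump d, True) v)"
      using Cons.IH[OF normal_ConsD[OF prems(1)], of "i + jump d" "m + jump d"] prems(2)
      by (cases d) (simp_all add: algebra_simps)
    then show "push (m, True) (push (i, True) ((j, d) # v))
        = push (i, True) (push (m + q, True) ((j, d) # v))"
      by (simp only: push_swap[OF swap] push_swap[OF 1(1,2)] push_swap[OF 1(3,4)])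
  qed
qed

section \<open>Translation of indices and the action on normal words\<close>

definition shift :: "int \<Rightarrow> int gword \<Rightarrow> int gword" where
  "shift c = map (\<lambda>(m, e). (m + c, e))"

lemma shift_simps [simp]:
  "shift c [] = []" "shift c ((m, e) # v) = (m + c, e) # shift c v"
  "shift c (shift d v) = shift (d + c) v" "shift 0 v = v"
  by (auto simp: shift_def comp_def case_prod_beta algebra_simps)

lemma admissible_shift: "admissible (m + c, e) (i + c, d) = admissible (m, e) (i, d)"
  by auto

lemma normal_shift [simp]: "normal (shift c v) = normal v"
  by (auto simp: shift_def successively_map case_prod_beta' simp del: admissible.simps
      intro!: successively_cong) (simp_all add: admissible_shift del: admissible.simps)

lemma push_shift: "push (m + c, e) (shift c v) = shift c (push (m, e) v)"
  by (induction "(m, e)" v arbitrary: m rule: push.induct)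
    (auto simp: algebra_simps admissible_shift)

text \<open>A pair \<open>(v, s)\<close> stands for v followed by x_0^s. Moving x_0 or its inverse
  from the left across \<open>v\<close> translates all indices by -q or q; for \<open>j\<close>
  positive, x_j is y_j.\<close>

fun act :: "nat \<times> bool \<Rightarrow> int gword \<times> int \<Rightarrow> int gword \<times> int" where
  "act (j, e) (v, s) =
    (if j = 0 then (shift (- jump e) v, s + (if e then 1 else - 1)) else (push (int j, e) v, s))"

lemma normal_act: "normal (fst t) \<Longrightarrow> normal (fst (act l t))"
  by (cases l; cases t) (auto simp: normal_push)

lemma normal_foldr_act: "normal (fst t) \<Longrightarrow> normal (fst (foldr act w t))"
  by (induction w) (auto simp: normal_act)

text \<open>A defining relation with \<open>i = 0\<close> amounts to the compatibility of
  \<open>push\<close> with translations, one with \<open>i > 0\<close> to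
  \<open>push_commute\<close>.\<close>

lemma foldr_act_pres_cong:
  assumes "(u, w) \<in> pres_cong (thompson_rels p)" "normal (fst t)"
  shows "foldr act u t = foldr act w t"
  using assms
proof (induction arbitrary: t rule: pres_cong.induct)
  case (rel u v)
  obtain i j where uv: "u = [(j, True), (i, True)]" "v = [(i, True), (j + p - 1, True)]" "i < j"
    using rel(1) by (auto simp: thompson_rels_def)
  have j: "int (j + p - Suc 0) = int j + q" "j + p - Suc 0 \<noteq> 0" using p_ge_2 uv(3) by (auto simp: q_def)
  obtain v s where t: "t = (v, s)" by (cases t)
  show ?case
  proof (cases "i = 0")
    case True
    then show ?thesis using uv t j push_shift[of "int j + q" "- q" True v] by (simp del: of_nat_diff)
  next
    case False
    then show ?thesis using uv t j push_commute[of v "int i" "int j"] rel(2)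
      by (simp del: of_nat_diff)
  qed
next
  case (cancel x e)
  then show ?case using push_cancel[of "fst t" "int x" "\<not> e"] by (cases t) auto
next
  case (append u u' v v')
  then show ?case by (simp add: normal_foldr_act)
qed auto

end

section \<open>Forbidden subwords and regularity\<close>

text \<open>States of any countable type are renamed by the injection \<open>to_nat\<close>.\<close>

lemma regular_languageI:
  fixes Q :: "'s::countable set" and \<delta> :: "'s \<Rightarrow> 'a \<Rightarrow> 's"
  assumes "finite A" "L \<subseteq> lists A" "finite Q" "q0 \<in> Q" "F \<subseteq> Q"
    and "\<And>t a. t \<in> Q \<Longrightarrow> a \<in> A \<Longrightarrow> \<delta> t a \<in> Q"
    and "\<And>w. w \<in> lists A \<Longrightarrow> w \<in> L \<longleftrightarrow> foldl \<delta> q0 w \<in> F"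
  shows "regular_language A L"
proof -
  let ?\<delta> = "\<lambda>n a. to_nat (\<delta> (from_nat n) a)"
  have foldl: "foldl ?\<delta> (to_nat q0) w = to_nat (foldl \<delta> q0 w)" for w
    by (induction w rule: rev_induct) auto
  show ?thesis
    unfolding regular_language_def
  proof (intro conjI exI ballI)
    show "finite (to_nat ` Q)" "to_nat q0 \<in> to_nat ` Q" "to_nat ` F \<subseteq> to_nat ` Q"
      using assms(3-5) by auto
    show "?\<delta> n a \<in> to_nat ` Q" if "n \<in> to_nat ` Q" "a \<in> A" for n a
      using that assms(6) by fastforce
    show "w \<in> L \<longleftrightarrow> foldl ?\<delta> (to_nat q0) w \<in> to_nat ` F" if "w \<in> lists A" for w
      using assms(7)[OF that] by (simp only: foldl inj_image_mem_iff[OF inj_to_nat])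
  qed (rule assms(1,2))+
qed

context generalized_thompson
begin

text \<open>\<open>m = a - k q\<close> with \<open>a = residue m \<in> {1..q}\<close> and \<open>k = conj_exp m\<close>, so that \<open>y\<^sub>m = x\<^sub>0\<^sup>k x\<^sub>a
  x\<^sub>0\<^sup>-\<^sup>k\<close>.\<close>

definition conj_exp :: "int \<Rightarrow> int" where "conj_exp m = - ((m - 1) div q)"
definition residue :: "int \<Rightarrow> nat" where "residue m = nat ((m - 1) mod q + 1)"

lemma int_p: "int (p - 1) = q"
  using p_ge_2 by (simp add: q_def)

lemma residue_bounds: "1 \<le> residue m" "residue m \<le> p - 1"
proof -
  have "0 \<le> (m - 1) mod q" "(m - 1) mod q < q" using q_pos by simp_all
  then have "1 \<le> int (residue m)" "int (residue m) \<le> int (p - 1)" unfolding int_p by (simp_all add: residue_def)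
  then show "1 \<le> residue m" "residue m \<le> p - 1" by simp_all
qed

lemma residue_conj_exp: "int (residue m) - conj_exp m * q = m"
proof -
  have "0 \<le> (m - 1) mod q" using q_pos by simp
  then have "int (residue m) - conj_exp m * q = (m - 1) div q * q + (m - 1) mod q + 1"
    by (simp add: residue_def conj_exp_def)
  then show ?thesis by (simp only: div_mult_mod_eq)
qed

lemma conj_exp_residue_unique:
  assumes "1 \<le> b" "b \<le> p - 1"
  shows "conj_exp (int b - c * q) = c" "residue (int b - c * q) = b"
proof -
  have b: "0 \<le> int b - 1" "int b - 1 < q" using assms int_p by linarith+
  have e: "int b - c * q - 1 = int b - 1 + (- c) * q" by simp
  show "conj_exp (int b - c * q) = c"
    unfolding conj_exp_def e using b by (subst div_mult_self1) simp_all
  show "residue (int b - c * q) = b"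
    unfolding residue_def e using b by (subst mod_mult_self1) simp_all
qed

section \<open>Passing between words in the generators and words in the y-letters\<close>

abbreviation sgn_exp :: "bool \<Rightarrow> int" where "sgn_exp e \<equiv> (if e then 1 else - 1)"

definition xpow :: "int \<Rightarrow> nat gword" where
  "xpow k = replicate (nat \<bar>k\<bar>) (0, 0 < k)"

lemma xpow_0 [simp]: "xpow 0 = []"
  by (simp add: xpow_def)

lemma xpow_Cons: "\<not> (if e then k < 0 else 0 < k) \<Longrightarrow> xpow (k + sgn_exp e) = (0, e) # xpow k"
proof -
  assume sign: "\<not> (if e then k < 0 else 0 < k)"
  then have "nat \<bar>k + sgn_exp e\<bar> = Suc (nat \<bar>k\<bar>)" "(0 < k + sgn_exp e) = e" "k \<noteq> 0 \<Longrightarrow> (0 < k) = e"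
    by (cases e; simp)+
  then show ?thesis by (cases "k = 0") (simp_all add: xpow_def)
qed

lemma xpow_snoc:
  assumes "\<not> (if e then k < 0 else 0 < k)"
  shows "xpow (k + sgn_exp e) = xpow k @ [(0, e)]"
proof -
  have "rev (xpow n) = xpow n" for n by (simp add: xpow_def)
  then have "xpow (k + sgn_exp e) = rev ((0, e) # xpow k)" by (metis xpow_Cons[OF assms])
  also have "\<dots> = xpow k @ [(0, e)]" using \<open>\<And>n. rev (xpow n) = xpow n\<close> by simp
  finally show ?thesis .
qed

text \<open>\<open>decode c v s\<close> is a word for \<open>x\<^sub>0\<^sup>-\<^sup>c v x\<^sub>0\<^sup>s\<close>, and \<open>encode c w\<close> is the list of \<open>y\<close>-letters
  of \<open>x\<^sub>0\<^sup>c w\<close>.\<close>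

fun decode :: "int \<Rightarrow> int gword \<Rightarrow> int \<Rightarrow> nat gword" where
  "decode c [] s = xpow (s - c)"
| "decode c ((m, e) # v) s = xpow (conj_exp m - c) @ (residue m, e) # decode (conj_exp m) v s"

lemma decode_snoc: "decode c (v @ [(m, e)]) s = decode c v (conj_exp m) @ (residue m, e) # xpow (s - conj_exp m)"
  by (induction v arbitrary: c) auto

lemma decode_in_lists: "decode c v s \<in> lists (alphabet p)"
  by (induction c v s rule: decode.induct) (use residue_bounds in \<open>auto simp: xpow_def alphabet_def\<close>)

fun x0_sum :: "nat gword \<Rightarrow> int" where
  "x0_sum [] = 0"
| "x0_sum ((b, e) # w) = (if b = 0 then sgn_exp e else 0) + x0_sum w"

fun encode :: "int \<Rightarrow> nat gword \<Rightarrow> int gword" where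
  "encode c [] = []"
| "encode c ((b, e) # w) = (if b = 0 then encode (c + sgn_exp e) w else (int b - c * q, e) # encode c w)"

lemma x0_sum_append [simp]: "x0_sum (w @ w') = x0_sum w + x0_sum w'"
  by (induction w rule: x0_sum.induct) auto

lemma encode_append [simp]: "encode c (w @ w') = encode c w @ encode (c + x0_sum w) w'"
  by (induction c w rule: encode.induct) (auto simp: algebra_simps)

lemma encode_shift: "encode (c + d) w = shift (- d * q) (encode c w)"
  by (induction c w rule: encode.induct) (auto simp: algebra_simps)

lemma x0_sum_xpow [simp]: "x0_sum (xpow k) = k"
proof -
  have "x0_sum (replicate n (0, e)) = int n * sgn_exp e" for n e by (induction n) (auto simp: algebra_simps)
  then show ?thesis by (auto simp: xpow_def)
qed

lemma encode_xpow [simp]: "encode c (xpow k) = []"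
proof -
  have "encode c (replicate n (0, e)) = []" for n e by (induction n arbitrary: c) auto
  then show ?thesis by (simp add: xpow_def)
qed

lemma x0_sum_decode: "x0_sum (decode c v s) = s - c"
proof (induction c v s rule: decode.induct)
  case (2 c m e v s)
  then show ?case using residue_bounds(1)[of m] by simp
qed simp

lemma encode_decode: "encode c (decode c v s) = v"
proof (induction c v s rule: decode.induct)
  case (2 c m e v s)
  then show ?case using residue_bounds(1)[of m] residue_conj_exp[of m] by simp
qed simp

text \<open>Suffixes of \<open>w\<close> have normal encodings too, up to translation, so every
  \<open>push\<close> merely prepends its letter.\<close>

lemma foldr_act_eq: "normal (encode 0 w) \<Longrightarrow> foldr act w ([], 0) = (encode 0 w, x0_sum w)"
proof (induction w)
  case (Cons l w)
  obtain b e where l: "l = (b, e)" by (cases l)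
  show ?case
  proof (cases "b = 0")
    case True
    have "encode 0 (l # w) = shift (- jump e) (encode 0 w)"
      using True l encode_shift[of 0 "sgn_exp e" w] by auto
    then show ?thesis using True l Cons by auto
  next
    case False
    then have "normal ((int b, e) # encode 0 w)" using Cons l by simp
    then show ?thesis using False l Cons normal_ConsD push_normal_Cons by auto
  qed
qed simp

section \<open>Reading a word letter by letter\<close>

text \<open>A state holds the last letter other than \<open>x\<^sub>0\<close> and the exponent of \<open>x\<^sub>0\<close> after it. As the
  admissibility of two letters is invariant under translation, the power of \<open>x\<^sub>0\<close> in front of
  the stored letter is irrelevant.\<close>

type_synonym state = "(nat \<times> bool) option \<times> int"

fun step :: "state \<Rightarrow> nat \<times> bool \<Rightarrow> state option" where
  "step (L, k) (b, e) =
    (if b = 0 then if (if e then k < 0 else 0 < k) then None else Some (L, k + sgn_exp e)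
     else case L of None \<Rightarrow> Some (Some (b, e), 0)
       | Some (a, d) \<Rightarrow> if admissible (int a + k * q, d) (int b, e) then Some (Some (b, e), 0) else None)"

definition run :: "nat gword \<Rightarrow> state option" where
  "run = foldl (\<lambda>t l. Option.bind t (\<lambda>t. step t l)) (Some (None, 0))"

lemma run_Nil [simp]: "run [] = Some (None, 0)"
  by (simp add: run_def)

lemma run_snoc [simp]: "run (w @ [l]) = Option.bind (run w) (\<lambda>t. step t l)"
  by (simp add: run_def)

text \<open>Recovers the end of the word from the state, so that a failing step can be matched with
  a suffix.\<close>

lemma run_tail:
  assumes "run w = Some (L, k)"
  shows "\<exists>r. rev w = xpow k @ r \<and>
    (case L of None \<Rightarrow> r = [] | Some l \<Rightarrow> fst l \<noteq> 0 \<and> (\<exists>r'. r = l # r'))"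
  using assms
proof (induction w arbitrary: L k rule: rev_induct)
  case (snoc l w)
  obtain b e where l: "l = (b, e)" by (cases l)
  obtain L' k' where run: "run w = Some (L', k')" "step (L', k') l = Some (L, k)"
    using snoc.prems by (cases "run w") auto
  show ?case
  proof (cases "b = 0")
    case True
    then show ?thesis using run(2) snoc.IH[OF run(1)] l xpow_Cons[of e k'] by (auto split: if_splits)
  next
    case False
    then show ?thesis using run(2) l by (auto split: option.splits if_splits prod.splits)
  qed
qed simp

section \<open>Forbidden subwords as inadmissible pairs\<close>

lemma not_admissible: "i < m \<Longrightarrow> \<not> admissible (m, e) (i, True)" "i + q < m \<Longrightarrow> \<not> admissible (m, e) (i, False)"
  by auto

text \<open>As \<open>a\<close> and \<open>b\<close> lie between 1 and q, a + nq > b means that b <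
  a or n \<ge> 1, and a + nq > b + q means that n \<ge> 2, or n = 1 and b < a. A cancelling pair
  other than one of x_0 is the case n = 0, a = b.\<close>

lemma forbidden_eq:
  "forbidden p = {[(0, e), (0, \<not> e)] | e. True}
    \<union> {(a, d) # replicate n (0, True) @ [(b, e)] | a d n b e.
        1 \<le> a \<and> a \<le> p - 1 \<and> 1 \<le> b \<and> b \<le> p - 1 \<and> \<not> admissible (int a + int n * q, d) (int b, e)}"
    (is "_ = ?A \<union> ?B")
proof (intro equalityI subsetI)
  have BI: "(a, d) # replicate n (0, True) @ [(b, e)] \<in> ?B"
    if "1 \<le> a" "a \<le> p - 1" "1 \<le> b" "b \<le> p - 1" "\<not> admissible (int a + int n * q, d) (int b, e)" for a d n b e
    using that by blast
  have kq: "0 \<le> int k * q" for k using q_pos by simp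
  fix f assume "f \<in> forbidden p"
  then show "f \<in> ?A \<union> ?B"
    unfolding forbidden_def
  proof (elim UnE CollectE exE conjE)
    fix i e assume f: "i \<le> p - 1" "f = [(i, e), (i, \<not> e)]"
    show ?thesis
    proof (cases "i = 0")
      case True
      then show ?thesis using f(2) by blast
    next
      case False
      then have "f \<in> ?B" using BI[of i i 0 e "\<not> e"] f by simp
      then show ?thesis by blast
    qed
  next
    fix a b e k
    assume f: "f = [(a, e)] @ replicate k (0, True) @ [(b, True)]" "1 \<le> b" "b < a" "a \<le> p - 1"
    have "\<not> admissible (int a + int k * q, e) (int b, True)"
      using f(3) kq[of k] by (intro not_admissible) linarith
    then have "f \<in> ?B" unfolding f(1) append_Cons append_Nil by (intro BI) (use f in simp_all)
    then show ?thesis by blast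
  next
    fix a b e k
    assume f: "f = [(a, e)] @ replicate (k + 1) (0, True) @ [(b, False)]" "1 \<le> b" "b < a" "a \<le> p - 1"
    have "\<not> admissible (int a + int (k + 1) * q, e) (int b, False)"
    proof (rule not_admissible)
      have "int (k + 1) * q = int k * q + 1 * q" by (simp add: algebra_simps)
      then show "int b + q < int a + int (k + 1) * q" using f kq[of k] q_pos by linarith
    qed
    then have "f \<in> ?B" unfolding f(1) append_Cons append_Nil by (intro BI) (use f in simp_all)
    then show ?thesis by blast
  next
    fix a b e k
    assume f: "f = [(a, e)] @ replicate (k + 1) (0, True) @ [(b, True)]" "1 \<le> a" "a \<le> b" "b \<le> p - 1"
    then have bq: "int b \<le> q" using int_p by linarith
    have "\<not> admissible (int a + int (k + 1) * q, e) (int b, True)"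
    proof (rule not_admissible)
      have "int (k + 1) * q = int k * q + 1 * q" by (simp add: algebra_simps)
      then show "int b < int a + int (k + 1) * q" using f bq kq[of k] q_pos by linarith
    qed
    then have "f \<in> ?B" unfolding f(1) append_Cons append_Nil by (intro BI) (use f in simp_all)
    then show ?thesis by blast
  next
    fix a b e k
    assume f: "f = [(a, e)] @ replicate (k + 2) (0, True) @ [(b, False)]" "1 \<le> a" "a \<le> b" "b \<le> p - 1"
    then have bq: "int b \<le> q" using int_p by linarith
    have "\<not> admissible (int a + int (k + 2) * q, e) (int b, False)"
    proof (rule not_admissible)
      have "int (k + 2) * q = int k * q + 2 * q" by (simp add: algebra_simps)
      then show "int b + q < int a + int (k + 2) * q" using f bq kq[of k] q_pos by linarith
    qed
    then have "f \<in> ?B" unfolding f(1) append_Cons append_Nil by (intro BI) (use f in simp_all)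
    then show ?thesis by blast
  qed
next
  fix f assume "f \<in> ?A \<union> ?B"
  then consider (1) e where "f = [(0, e), (0, \<not> e)]"
    | (2) a d n b e where "f = (a, d) # replicate n (0, True) @ [(b, e)]" "1 \<le> a" "a \<le> p - 1"
      "1 \<le> b" "b \<le> p - 1" "\<not> admissible (int a + int n * q, d) (int b, e)"
    by blast
  then show "f \<in> forbidden p"
  proof cases
    case 1
    then show ?thesis unfolding forbidden_def by blast
  next
    case 2
    have ab: "int a \<le> q" "int b \<le> q" using 2 int_p by linarith+
    \<comment> \<open>The inequalities depend on \<open>n\<close> only through these three
      cases.\<close>
    have n: "n = 0 \<or> n = 1 \<or> (\<exists>k. n = k + 2)"
      by (metis One_nat_def add_2_eq_Suc' not0_implies_Suc)
    have kq: "0 \<le> int k * q" for k using q_pos by simp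
    consider (c1) "n = 0" "a = b" "d = (\<not> e)" | (c2) "e" "b < a" | (c3) k where "\<not> e" "b < a" "n = k + 1"
      | (c4) k where "e" "a \<le> b" "n = k + 1" | (c5) k where "\<not> e" "a \<le> b" "n = k + 2"
    proof -
      from n show thesis
      proof (elim disjE exE)
        assume "n = 0"
        then show thesis using 2 ab that(1,2) by (cases e) (auto split: if_splits)
      next
        assume n: "n = 1"
        then have "a > b \<or> e" using 2 ab by (cases e) auto
        then show thesis using that(2)  that(3)[of 0] that(4)[of 0] n by (cases "b < a"; cases e) auto
      next
        fix k assume "n = k + 2"
        then show thesis using that(2)  that(3)[of "k + 1"] that(4)[of "k + 1"] that(5)[of k]
          by (cases "b < a"; cases e) auto
      qed
    qed
    then show ?thesis
    proof cases
      case c1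
      have "[(a, d), (a, \<not> d)] \<in> forbidden p" using 2 unfolding forbidden_def by blast
      then show ?thesis using c1 2 by simp
    next
      case c2
      then have "f = [(a, d)] @ replicate n (0, True) @ [(b, True)]" using 2 by simp
      then show ?thesis using c2 2 unfolding forbidden_def by blast
    next
      case c3
      then have "f = [(a, d)] @ replicate (k + 1) (0, True) @ [(b, False)]" using 2 by simp
      then show ?thesis using c3 2 unfolding forbidden_def by blast
    next
      case c4
      then have "f = [(a, d)] @ replicate (k + 1) (0, True) @ [(b, True)]" using 2 by simp
      then show ?thesis using c4 2 unfolding forbidden_def by blast
    next
      case c5
      then have "f = [(a, d)] @ replicate (k + 2) (0, True) @ [(b, False)]" using 2 by simp
      then show ?thesis using c5 2 unfolding forbidden_def by blast
    qed
  qed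
qed

text \<open>Both sides are split at the first letter other than x_0.\<close>

lemma letter_prefix_unique:
  assumes "replicate n (0, True) @ (a, d) # r = xpow k @ r'" "a \<noteq> (0::nat)"
    and "r' = [] \<or> fst (hd r') \<noteq> 0"
  shows "xpow k = replicate n (0, True)" "r' = (a, d) # r"
proof -
  let ?P = "\<lambda>l. fst l = (0::nat)"
  have "takeWhile ?P (replicate n (0, True) @ (a, d) # r) = replicate n (0, True)"
    "dropWhile ?P (replicate n (0, True) @ (a, d) # r) = (a, d) # r"
    using assms(2) by (simp_all add: takeWhile_append dropWhile_append)
  moreover have "takeWhile ?P (xpow k @ r') = xpow k" "dropWhile ?P (xpow k @ r') = r'"
    using assms(3) by (cases r'; simp add: takeWhile_append dropWhile_append xpow_def)+
  ultimately show "xpow k = replicate n (0, True)" "r' = (a, d) # r"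
    using assms(1) by simp_all
qed

text \<open>A forbidden word ending in x_0 or its inverse is a cancelling pair. Any other one
  reaches back exactly to the previous letter different from x_0, which is the letter stored in the
  state.\<close>

lemma step_None_iff:
  assumes "run w = Some t" "w \<in> lists (alphabet p)" "l \<in> alphabet p"
  shows "step t l = None \<longleftrightarrow> (\<exists>f\<in>forbidden p. suffix f (w @ [l]))"
proof -
  obtain L k where t: "t = (L, k)" by (cases t)
  obtain b e where l: "l = (b, e)" by (cases l)
  have b: "b \<le> p - 1" using assms(3) l by (simp add: alphabet_def)
  obtain r where r: "rev w = xpow k @ r"
      "case L of None \<Rightarrow> r = [] | Some l \<Rightarrow> fst l \<noteq> 0 \<and> (\<exists>r'. r = l # r')"
    using run_tail assms(1) t by blast
  then have r': "r = [] \<or> fst (hd r) \<noteq> 0" by (auto split: option.splits)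
  have suffix: "suffix f (w @ [l]) \<longleftrightarrow> prefix (rev f) (l # rev w)" for f
    by (simp add: suffix_to_prefix)
  show ?thesis
  proof (cases "b = 0")
    case True
    have "(\<exists>f\<in>forbidden p. suffix f (w @ [l])) \<longleftrightarrow> prefix [(0, \<not> e)] (rev w)"
    proof
      assume "\<exists>f\<in>forbidden p. suffix f (w @ [l])"
      then obtain f where f: "f \<in> forbidden p" "suffix f (w @ [(0, e)])" using True l by blast
      from f(1) consider e' where "f = [(0, e')] @ [(0, \<not> e')]"
        | f' b' e' where "f = f' @ [(b', e')]" "1 \<le> b'"
        unfolding forbidden_eq by fastforce
      then show "prefix [(0, \<not> e)] (rev w)"
        using f(2) by cases (auto simp: suffix_to_prefix)
    next
      assume "prefix [(0, \<not> e)] (rev w)"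
      then have "suffix ([(0, \<not> e)] @ [(0, e)]) (w @ [l])"
        using True l by (simp add: suffix_to_prefix)
      moreover have "[(0, \<not> e)] @ [(0, e)] \<in> forbidden p"
        unfolding forbidden_eq by (intro UnI1 CollectI exI[of _ "\<not> e"]) simp
      ultimately show "\<exists>f\<in>forbidden p. suffix f (w @ [l])" by blast
    qed
    also have "\<dots> \<longleftrightarrow> (if e then k < 0 else 0 < k)"
    proof (cases "k = 0")
      case True
      then show ?thesis using r(1) r' by (cases r) auto
    next
      case False
      then have "xpow k = (0, 0 < k) # xpow (k - sgn_exp (0 < k))" using xpow_Cons[of "0 < k" "k - sgn_exp (0 < k)"] by auto
      then show ?thesis using r(1) False by auto
    qed
    finally show ?thesis using True l t by simp
  next
    case False
    show ?thesis
    proof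
      assume "step t l = None"
      then obtain a d where L: "L = Some (a, d)" "\<not> admissible (int a + k * q, d) (int b, e)"
        using False l t by (auto simp del: admissible.simps split: option.splits if_splits)
      then obtain r'' where r'': "a \<noteq> 0" "rev w = xpow k @ (a, d) # r''" using r by auto
      have "(a, d) \<in> set w" using r''(2) by (metis in_set_conv_decomp set_rev)
      then have a: "a \<le> p - 1" using assms(2) by (auto simp: alphabet_def)
      \<comment> \<open>For negative \<open>k\<close> the translated index is at most a - q, hence
        at most 0 < b, and the step succeeds.\<close>
      have "k \<ge> 0"
      proof (rule ccontr)
        assume "\<not> k \<ge> 0"
        then have "(k + 1) * q \<le> 0" using q_pos by (intro mult_nonpos_nonneg) auto
        then have "int a + k * q \<le> 0" using a int_p by (simp add: algebra_simps)
        then have "admissible (int a + k * q, d) (int b, e)" using False q_pos by auto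
        then show False using L by blast
      qed
      then have x: "xpow k = replicate (nat k) (0, True)" "int (nat k) = k"
        by (cases "k = 0"; simp add: xpow_def)+
      let ?f = "(a, d) # replicate (nat k) (0, True) @ [(b, e)]"
      have "?f \<in> forbidden p"
        unfolding forbidden_eq using L(2) x(2) r''(1) a b False
        by (intro UnI2 CollectI exI[of _ a] exI[of _ d] exI[of _ "nat k"] exI[of _ b] exI[of _ e])
          (simp del: admissible.simps)
      moreover have "suffix ?f (w @ [l])"
      proof -
        have "w = rev r'' @ (a, d) # replicate (nat k) (0, True)"
          using r''(2) by (simp add: rev_swap x(1))
        then have "w @ [l] = rev r'' @ ?f" by (simp add: l)
        then show ?thesis unfolding suffix_def by blast
      qed
      ultimately show "\<exists>f\<in>forbidden p. suffix f (w @ [l])" by blast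
    next
      assume "\<exists>f\<in>forbidden p. suffix f (w @ [l])"
      then obtain f where f: "f \<in> forbidden p" "prefix (rev f) (l # rev w)" unfolding suffix by blast
      then obtain a d n where a: "f = (a, d) # replicate n (0, True) @ [(b, e)]" "1 \<le> a"
          "\<not> admissible (int a + int n * q, d) (int b, e)"
      proof -
        from f(1) show thesis
          unfolding forbidden_eq
        proof (elim UnE CollectE exE conjE)
          fix e' assume "f = [(0, e'), (0, \<not> e')]"
          then show thesis using f(2) False l by simp
        next
          fix a d n b' e'
          assume f': "f = (a, d) # replicate n (0, True) @ [(b', e')]" "1 \<le> a"
            "\<not> admissible (int a + int n * q, d) (int b', e')"
          moreover have "b' = b" "e' = e" using f(2) f'(1) l by simp_all
          ultimately show thesis using that by blast
        qed
      qed
      then obtain r'' where "rev w = replicate n (0, True) @ (a, d) # r''"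
        using f(2) l by (auto simp: prefix_def)
      then have "replicate n (0, True) @ (a, d) # r'' = xpow k @ r" using r by simp
      from letter_prefix_unique[OF this _ r'] have x: "xpow k = replicate n (0, True)" "r = (a, d) # r''"
        using a(2) by simp_all
      have "x0_sum (xpow k) = x0_sum (replicate n (0, True))" by (simp only: x(1))
      also have "\<dots> = int n" by (induction n) auto
      finally have "k = int n" by simp
      moreover have "L = Some (a, d)" using r(2) x(2) by (auto split: option.splits)
      ultimately show "step t l = None" using t l False a(3) by (simp del: admissible.simps)
    qed
  qed
qed

lemma run_None_iff:
  "w \<in> lists (alphabet p) \<Longrightarrow> run w = None \<longleftrightarrow> (\<exists>f\<in>forbidden p. sublist f w)"
proof (induction w rule: rev_induct)
  case Nil
  then show ?case by (auto simp: forbidden_eq)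
next
  case (snoc l w)
  then show ?case
    using step_None_iff[of w _ l] by (cases "run w") (auto simp: sublist_snoc)
qed

section \<open>Accepted words correspond to normal words\<close>

lemma N_fin_iff: "w \<in> N_fin p \<longleftrightarrow> w \<in> lists (alphabet p) \<and> run w \<noteq> None"
  unfolding N_fin_def mem_Collect_eq
  by (cases "w \<in> lists (alphabet p)") (simp_all add: run_None_iff del: not_None_eq)

text \<open>The powers of x_0 before the stored letter add up to \<open>x0_sum w - k\<close>, which
  gives the index of the last y-letter. Since no power of x_0 in an accepted word cancels, decoding
  gives back the word itself.\<close>

lemma run_normal:
  assumes "run w = Some (L, k)" "w \<in> lists (alphabet p)"
  shows "normal (encode 0 w) \<and> w = decode 0 (encode 0 w) (x0_sum w) \<and>
    (case L of None \<Rightarrow> encode 0 w = [] \<and> k = x0_sum w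
      | Some (a, d) \<Rightarrow> 1 \<le> a \<and> a \<le> p - 1 \<and> (\<exists>v. encode 0 w = v @ [(int a - (x0_sum w - k) * q, d)]))"
  using assms
proof (induction w arbitrary: L k rule: rev_induct)
  case (snoc l w)
  obtain b e where l: "l = (b, e)" by (cases l)
  have b: "b \<le> p - 1" using snoc.prems l by (simp add: alphabet_def)
  obtain L' k' where run: "run w = Some (L', k')" "step (L', k') l = Some (L, k)"
    using snoc.prems by (cases "run w") auto
  note IH = snoc.IH[OF run(1)]
  have w: "w \<in> lists (alphabet p)" using snoc.prems by simp
  have IH1: "normal (encode 0 w)" "w = decode 0 (encode 0 w) (x0_sum w)" using IH w by blast+
  show ?case
  proof (cases "b = 0")
    case True
    then have s: "\<not> (if e then k' < 0 else 0 < k')" "L = L'" "k = k' + sgn_exp e"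
      using run(2) l by (auto split: if_splits)
    have encode: "encode 0 (w @ [l]) = encode 0 w" "x0_sum (w @ [l]) = x0_sum w + sgn_exp e" using True l by simp_all
    have "decode 0 (encode 0 w) (x0_sum w + sgn_exp e) = decode 0 (encode 0 w) (x0_sum w) @ [(0, e)]"
    proof (cases L')
      case None
      then have "encode 0 w = []" "k' = x0_sum w" using IH w by auto
      then show ?thesis using xpow_snoc[OF s(1)] by simp
    next
      case (Some ad)
      obtain a d where ad: "ad = (a, d)" by (cases ad)
      define m where "m = int a - (x0_sum w - k') * q"
      obtain v where v: "1 \<le> a" "a \<le> p - 1" "encode 0 w = v @ [(m, d)]"
        unfolding m_def using IH w Some ad by auto
      have m: "conj_exp m = x0_sum w - k'"
        unfolding m_def by (rule conj_exp_residue_unique[OF v(1,2)])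
      have "x0_sum w + sgn_exp e - conj_exp m = k' + sgn_exp e" "x0_sum w - conj_exp m = k'" by (simp_all add: m)
      then show ?thesis unfolding v(3) decode_snoc by (simp only: xpow_snoc[OF s(1)]) simp
    qed
    then have "w @ [l] = decode 0 (encode 0 w) (x0_sum w + sgn_exp e)" using IH1(2) l True by simp
    moreover have "x0_sum w + sgn_exp e - k = x0_sum w - k'" using s by simp
    ultimately show ?thesis using IH w s(2,3) unfolding encode by (auto split: option.splits)
  next
    case False
    have encode: "encode 0 (w @ [l]) = encode 0 w @ [(int b - x0_sum w * q, e)]" "x0_sum (w @ [l]) = x0_sum w" using False l by simp_all
    have Lk: "L = Some (b, e)" "k = 0" using run(2) False l by (auto split: option.splits if_splits)
    have "normal (encode 0 w @ [(int b - x0_sum w * q, e)])"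
    proof (cases L')
      case None
      then show ?thesis using IH w by auto
    next
      case (Some ad)
      obtain a d where ad: "ad = (a, d)" by (cases ad)
      obtain v where v: "encode 0 w = v @ [(int a - (x0_sum w - k') * q, d)]"
        using IH w Some ad by auto
      have "admissible (int a + k' * q, d) (int b, e)" using run(2) l False Some ad by (auto split: if_splits)
      \<comment> \<open>Translation turns the test on the state into the test on the actual
        y-indices.\<close>
      then have "admissible (int a + k' * q + - (x0_sum w * q), d) (int b + - (x0_sum w * q), e)"
        by (simp only: admissible_shift)
      moreover have "int a + k' * q + - (x0_sum w * q) = int a - (x0_sum w - k') * q"
        "int b + - (x0_sum w * q) = int b - x0_sum w * q"
        by (simp_all add: algebra_simps)
      ultimately have "admissible (int a - (x0_sum w - k') * q, d) (int b - x0_sum w * q, e)"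
        by (simp only:)
      then show ?thesis using IH1(1) v by (simp add: successively_append_iff del: admissible.simps)
    qed
    moreover have "w @ [l] = decode 0 (encode 0 w @ [(int b - x0_sum w * q, e)]) (x0_sum w)"
      using conj_exp_residue_unique[of b "x0_sum w"] b False IH1(2) l by (simp add: decode_snoc)
    ultimately show ?thesis using Lk b False unfolding encode by simp
  qed
qed simp

lemma N_fin_normal: "w \<in> N_fin p \<Longrightarrow> normal (encode 0 w)"
  and N_fin_decode: "w \<in> N_fin p \<Longrightarrow> decode 0 (encode 0 w) (x0_sum w) = w"
  using run_normal[of w] by (auto simp: N_fin_iff)

lemma run_xpow: "run w = Some (L, 0) \<Longrightarrow> run (w @ xpow k) = Some (L, k)"
proof -
  assume "run w = Some (L, 0)"
  then have "run (w @ replicate n (0, e)) = Some (L, int n * sgn_exp e)" for n e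
  proof (induction n)
    case (Suc n)
    have "run (w @ replicate (Suc n) (0, e)) = Option.bind (run (w @ replicate n (0, e))) (\<lambda>t. step t (0, e))"
      by (simp only: replicate_Suc replicate_append_same[symmetric] append_assoc[symmetric] run_snoc)
    also have "\<dots> = Some (L, int (Suc n) * sgn_exp e)"
      unfolding Suc.IH[OF Suc.prems] by (auto simp: algebra_simps mult_less_0_iff zero_less_mult_iff)
    finally show ?case .
  qed simp
  then show "run (w @ xpow k) = Some (L, k)" by (auto simp: xpow_def)
qed

text \<open>Between the letters for y_n and y_m stands x_0 to the power
  \<open>conj_exp m - conj_exp n\<close>. The test made there is the admissibility of y_m after y_n,
  translated by \<open>conj_exp m * q\<close>. The induction uses the prefix with final exponent
  \<open>conj_exp m\<close>.\<close>

lemma run_decode: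
  "normal v \<Longrightarrow> run (decode 0 v s) = Some (if v = [] then (None, s)
    else (Some (residue (fst (last v)), snd (last v)), s - conj_exp (fst (last v))))"
proof (induction v arbitrary: s rule: rev_induct)
  case Nil
  then show ?case using run_xpow[of "[]" None s] by simp
next
  case (snoc x v)
  obtain m e where x: "x = (m, e)" by (cases x)
  have v: "normal v" using snoc.prems by (simp add: successively_append_iff)
  have "run (decode 0 v (conj_exp m) @ [(residue m, e)]) = Some (Some (residue m, e), 0)"
  proof (cases "v = []")
    case True
    then show ?thesis using snoc.IH[OF v, of "conj_exp m"] residue_bounds(1)[of m] by simp
  next
    case False
    obtain n d where l: "last v = (n, d)" by (cases "last v")
    have "admissible (n, d) (m, e)" using snoc.prems x l False by (simp add: successively_append_iff)
    then have "admissible (n + conj_exp m * q, d) (m + conj_exp m * q, e)" by (simp only: admissible_shift)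
    moreover have "n + conj_exp m * q = int (residue n) + (conj_exp m - conj_exp n) * q" "m + conj_exp m * q = int (residue m)"
      using residue_conj_exp[of n] residue_conj_exp[of m] by (simp_all add: algebra_simps)
    ultimately show ?thesis
      using snoc.IH[OF v, of "conj_exp m"] residue_bounds(1)[of m] False l by (simp del: admissible.simps)
  qed
  from run_xpow[OF this, of "s - conj_exp m"] show ?case
    by (simp add: x decode_snoc)
qed

lemma decode_in_N_fin: "normal v \<Longrightarrow> decode 0 v s \<in> N_fin p"
  by (simp add: N_fin_iff decode_in_lists run_decode)

section \<open>Finitely many states suffice\<close>

text \<open>For \<open>1 \<le> a, b \<le> q\<close>, a letter with index \<open>b\<close> is never admissible after one with index \<open>a + k q\<close> if
  \<open>k \<ge> 2\<close>, and always if \<open>k < 0\<close>.\<close>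

definition cap :: "int \<Rightarrow> int" where
  "cap k = max (- 1) (min 2 k)"

text \<open>A successful step by x_0 or its inverse moves the exponent away from 0, so an exponent
  that is negative or at least 2 remains so until the next other letter is read.\<close>

lemma step_cap:
  assumes "b \<le> p - 1" "L \<in> insert None (Some ` ({1..p - 1} \<times> UNIV))"
  shows "map_option (apsnd cap) (step (L, cap k) (b, e)) = map_option (apsnd cap) (step (L, k) (b, e))"
proof (cases "b = 0 \<or> L = None")
  case True
  then show ?thesis by (auto simp: cap_def)
next
  case False
  then obtain a d where L: "L = Some (a, d)" "1 \<le> a" "a \<le> p - 1" using assms by auto
  have ab: "1 \<le> int a" "int a \<le> q" "1 \<le> int b" "int b \<le> q" using L assms False int_p by linarith+
  consider "cap k = k" | "k > 2" "cap k = 2" | "k < - 1" "cap k = - 1"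
    by (force simp: cap_def)
  then have "admissible (int a + cap k * q, d) (int b, e) = admissible (int a + k * q, d) (int b, e)"
  proof cases
    case 2
    then have "2 * q \<le> k * q" using q_pos by (intro mult_right_mono) auto
    then have "int b + q < int a + k * q" using ab by linarith
    then show ?thesis using ab 2(2) q_pos by (cases e) auto
  next
    case 3
    then have "k * q \<le> - 1 * q" using q_pos by (intro mult_right_mono) auto
    then have "int a + k * q < int b" using ab by linarith
    then show ?thesis using ab 3(2) q_pos by (cases e) auto
  qed simp
  then show ?thesis using L False by (simp del: admissible.simps)
qed

lemma regular_N_fin: "regular_language (alphabet p) (N_fin p)"
proof -
  define \<delta> where "\<delta> = (\<lambda>t l. Option.bind t (\<lambda>t. map_option (apsnd cap) (step t l)))"
  \<comment> \<open>The outer \<open>None\<close> is the rejecting sink; the inner one means that no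
    letter other than x_0 has been read.\<close>
  define Q where "Q = insert None (Some ` (insert None (Some ` ({1..p - 1} \<times> (UNIV :: bool set))) \<times> {- 1..2 :: int}))"
  have foldl: "foldl \<delta> (Some (None, 0)) w = map_option (apsnd cap) (run w)"
    if "w \<in> lists (alphabet p)" for w
    using that
  proof (induction w rule: rev_induct)
    case Nil
    then show ?case by (simp add: cap_def)
  next
    case (snoc l w)
    obtain b e where l: "l = (b, e)" by (cases l)
    show ?case
    proof (cases "run w")
      case None
      then show ?thesis using snoc by (simp add: \<delta>_def)
    next
      case (Some t)
      obtain L k where t: "t = (L, k)" by (cases t)
      have "b \<le> p - 1" using snoc.prems l by (simp add: alphabet_def)
      moreover have "L \<in> insert None (Some ` ({1..p - 1} \<times> UNIV))"
        using run_normal[OF Some[unfolded t]] snoc.prems by (cases L) auto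
      ultimately show ?thesis
        using snoc Some step_cap[of b L k e] l t by (simp add: \<delta>_def del: step.simps)
    qed
  qed
  show ?thesis
  proof (rule regular_languageI[where Q = Q and F = "Q - {None}" and \<delta> = \<delta>])
    show "finite (alphabet p)" "finite Q" "Some (None, 0) \<in> Q" "Q - {None} \<subseteq> Q"
      by (auto simp: alphabet_def Q_def)
    show "N_fin p \<subseteq> lists (alphabet p)" by (auto simp: N_fin_def)
    show Q: "\<delta> t l \<in> Q" if "t \<in> Q" "l \<in> alphabet p" for t l
    proof (cases "\<delta> t l")
      case None
      then show ?thesis by (simp add: Q_def)
    next
      case (Some t')
      obtain b e where l: "l = (b, e)" by (cases l)
      obtain L k L' k' where t: "t = Some (L, k)" "step (L, k) (b, e) = Some (L', k')" "t' = (L', cap k')"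
        using Some l by (auto simp: \<delta>_def bind_eq_Some_conv simp del: step.simps)
      have "L' = L \<or> L' = Some (b, e) \<and> b \<noteq> 0"
        using t(2) by (auto simp del: admissible.simps split: if_splits option.splits)
      moreover have "L \<in> insert None (Some ` ({1..p - 1} \<times> UNIV))"
        using that(1) t(1) by (simp only: Q_def) blast
      ultimately have "L' \<in> insert None (Some ` ({1..p - 1} \<times> UNIV))"
        using that(2) l by (auto simp: alphabet_def)
      moreover have "cap k' \<in> {- 1..2}" by (simp add: cap_def)
      ultimately show ?thesis unfolding Some t(3) Q_def by blast
    qed
    fix w assume w: "w \<in> lists (alphabet p)"
    have "foldl \<delta> (Some (None, 0)) w \<in> Q"
      using w
    proof (induction w rule: rev_induct)
      case (snoc l w)
      then show ?case using Q by simp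
    qed (simp add: Q_def)
    then show "w \<in> N_fin p \<longleftrightarrow> foldl \<delta> (Some (None, 0)) w \<in> Q - {None}"
      using w by (auto simp: foldl N_fin_iff)
  qed
qed

end

section \<open>The action computes the value of a word\<close>

lemma word_value_Cons [simp]:
  "word_value G f ((x, e) # w) = (if e then f x else inv\<^bsub>G\<^esub> (f x)) \<otimes>\<^bsub>G\<^esub> word_value G f w"
  by (simp add: word_value_def)

lemma word_value_Nil [simp]: "word_value G f [] = \<one>\<^bsub>G\<^esub>"
  by (simp add: word_value_def)

lemma (in group) word_value_closed [simp]:
  "(\<And>x. f x \<in> carrier G) \<Longrightarrow> word_value G f w \<in> carrier G"
  by (induction w) auto

lemma (in group) inv_comm_right:
  assumes "a \<in> carrier G" "b \<in> carrier G" "c \<in> carrier G" "a \<otimes> b = b \<otimes> c"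
  shows "inv a \<otimes> b = b \<otimes> inv c"
proof -
  have "inv a \<otimes> b = inv a \<otimes> (b \<otimes> c) \<otimes> inv c" using assms(1-3) by (simp add: m_assoc)
  also have "\<dots> = b \<otimes> inv c" using assms(1-3) by (simp add: assms(4)[symmetric] m_assoc[symmetric])
  finally show ?thesis .
qed

lemma (in group) inv_comm_left:
  assumes "a \<in> carrier G" "b \<in> carrier G" "c \<in> carrier G" "a \<otimes> b = b \<otimes> c"
  shows "c \<otimes> inv b = inv b \<otimes> a"
proof -
  have "c \<otimes> inv b = inv b \<otimes> (b \<otimes> c) \<otimes> inv b" using assms(1-3) by (simp add: m_assoc[symmetric])
  also have "\<dots> = inv b \<otimes> a" using assms(1-3) by (simp add: assms(4)[symmetric] m_assoc)
  finally show ?thesis .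
qed

context generalized_thompson
begin

section \<open>The conjugates y_m as elements of the group\<close>

abbreviation G where "G \<equiv> thompson_F p"

abbreviation X :: "nat \<Rightarrow> nat gword set" where
  "X \<equiv> pres_gen (thompson_rels p)"

interpretation group G
  by (rule group_presented_group)

lemma X_closed [simp]: "X i \<in> carrier G"
  by (auto simp: pres_gen_def presented_group_def quotient_def)

lemma X_rel: "i < j \<Longrightarrow> X j \<otimes>\<^bsub>G\<^esub> X i = X i \<otimes>\<^bsub>G\<^esub> X (j + (p - 1))"
  unfolding pres_gen_def presented_group_mult
  using p_ge_2 by (intro equiv_class_eq[OF equiv_pres_cong] pres_cong.rel) (auto simp: thompson_rels_def)

definition x0_pow :: "int \<Rightarrow> nat gword set" where
  "x0_pow n = X 0 [^]\<^bsub>G\<^esub> n"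

lemma x0_pow_closed [simp]: "x0_pow n \<in> carrier G"
  by (simp add: x0_pow_def)

lemma x0_pow_0 [simp]: "x0_pow 0 = \<one>\<^bsub>G\<^esub>" and x0_pow_1: "x0_pow 1 = X 0" and x0_pow_minus_1: "x0_pow (- 1) = inv\<^bsub>G\<^esub> (X 0)"
  by (simp_all add: x0_pow_def int_pow_neg)

lemma x0_pow_add: "x0_pow (m + n) = x0_pow m \<otimes>\<^bsub>G\<^esub> x0_pow n"
  by (simp add: x0_pow_def int_pow_mult)

lemma x0_pow_mult [simp]: "x0_pow m \<otimes>\<^bsub>G\<^esub> x0_pow n = x0_pow (m + n)"
  "g \<in> carrier G \<Longrightarrow> x0_pow m \<otimes>\<^bsub>G\<^esub> (x0_pow n \<otimes>\<^bsub>G\<^esub> g) = x0_pow (m + n) \<otimes>\<^bsub>G\<^esub> g"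
  by (simp_all add: x0_pow_add m_assoc)

text \<open>This is y_m only if m + nq \<ge> 1; \<open>nat\<close> truncates a negative index to
  0.\<close>

definition y_at :: "int \<Rightarrow> int \<Rightarrow> nat gword set" where
  "y_at n m = x0_pow n \<otimes>\<^bsub>G\<^esub> (X (nat (m + n * q)) \<otimes>\<^bsub>G\<^esub> x0_pow (- n))"

definition y :: "int \<Rightarrow> nat gword set" where
  "y m = y_at (\<bar>m\<bar> + 1) m"

lemma y_at_closed [simp]: "y_at n m \<in> carrier G"
  by (simp add: y_at_def)

lemma y_closed [simp]: "y m \<in> carrier G"
  by (simp add: y_def)

text \<open>With j = m + nq, the relation x_j x_0 = x_0 x_{j+q} absorbs one further conjugation by
  x_0; it is available since j \<ge> 1.\<close>

lemma y_at_Suc: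
  assumes "m + n * q \<ge> 1"
  shows "y_at (n + 1) m = y_at n m"
proof -
  let ?j = "nat (m + n * q)"
  have j: "nat (m + (n + 1) * q) = ?j + (p - 1)"
    using assms p_ge_2 by (simp add: q_def algebra_simps nat_add_distrib)
  have "x0_pow 1 \<otimes>\<^bsub>G\<^esub> X (?j + (p - 1)) = X ?j \<otimes>\<^bsub>G\<^esub> x0_pow 1"
    using X_rel[of 0 ?j] assms by (simp add: x0_pow_1)
  then have "x0_pow 1 \<otimes>\<^bsub>G\<^esub> X (?j + (p - 1)) \<otimes>\<^bsub>G\<^esub> x0_pow (- n - 1) = X ?j \<otimes>\<^bsub>G\<^esub> x0_pow (- n)"
    by (simp add: m_assoc)
  moreover have "y_at (n + 1) m = x0_pow n \<otimes>\<^bsub>G\<^esub> (x0_pow 1 \<otimes>\<^bsub>G\<^esub> X (?j + (p - 1)) \<otimes>\<^bsub>G\<^esub> x0_pow (- n - 1))"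
    by (simp add: y_at_def j m_assoc)
  ultimately show ?thesis by (simp add: y_at_def)
qed

lemma y_at_mono:
  assumes "n \<le> n'" "m + n * q \<ge> 1"
  shows "y_at n' m = y_at n m"
  using assms
proof (induction rule: int_ge_induct)
  case (step k)
  have "n * q \<le> k * q" using step q_pos by (intro mult_right_mono) auto
  then show ?case using step y_at_Suc[of m k] by simp
qed simp

lemma abs_bound: "m + (\<bar>m\<bar> + 1) * q \<ge> 1"
proof -
  have "1 \<le> m + (\<bar>m\<bar> + 1) * 1" by (simp add: abs_if)
  also have "\<dots> \<le> m + (\<bar>m\<bar> + 1) * q" using q_pos by (intro add_left_mono mult_left_mono) auto
  finally show ?thesis .
qed

text \<open>Both exponents are compared with their maximum.\<close>

lemma y_eq: "m + n * q \<ge> 1 \<Longrightarrow> y m = y_at n m"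
  using y_at_mono[of n "max n (\<bar>m\<bar> + 1)" m] y_at_mono[of "\<bar>m\<bar> + 1" "max n (\<bar>m\<bar> + 1)" m] abs_bound[of m]
  by (simp add: y_def)

text \<open>Conjugation by x_0^c replaces the exponent n by n + c and keeps the index of the
  generator: (m - cq) + (n + c)q = m + nq.\<close>

lemma x0_pow_y: "x0_pow c \<otimes>\<^bsub>G\<^esub> y m = y (m - c * q) \<otimes>\<^bsub>G\<^esub> x0_pow c"
proof -
  let ?n = "\<bar>m\<bar> + 1"
  have "y (m - c * q) = y_at (?n + c) (m - c * q)"
    by (rule y_eq) (use abs_bound[of m] in \<open>simp add: algebra_simps\<close>)
  moreover have "m - c * q + (?n + c) * q = m + ?n * q" by (simp add: algebra_simps)
  ultimately have "y (m - c * q) = x0_pow (?n + c) \<otimes>\<^bsub>G\<^esub> (X (nat (m + ?n * q)) \<otimes>\<^bsub>G\<^esub> x0_pow (- (?n + c)))"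
    by (simp only: y_at_def)
  then show ?thesis by (simp add: y_def y_at_def m_assoc add.commute)
qed

text \<open>An exponent that suits the smallest index \<open>i\<close> suits all three elements, so
  the identity is a conjugate of a defining relation.\<close>

lemma y_rel:
  assumes "i < m"
  shows "y m \<otimes>\<^bsub>G\<^esub> y i = y i \<otimes>\<^bsub>G\<^esub> y (m + q)"
proof -
  define n where "n = \<bar>i\<bar> + 1"
  have i: "i + n * q \<ge> 1" unfolding n_def by (rule abs_bound)
  then have y: "y i = y_at n i" "y m = y_at n m" "y (m + q) = y_at n (m + q)"
    using assms q_pos by (auto intro!: y_eq)
  have j: "nat (m + q + n * q) = nat (m + n * q) + (p - 1)" 
    using i assms p_ge_2 by (simp add: q_def algebra_simps nat_add_distrib)
  have "y m \<otimes>\<^bsub>G\<^esub> y i = x0_pow n \<otimes>\<^bsub>G\<^esub> (X (nat (m + n * q)) \<otimes>\<^bsub>G\<^esub> X (nat (i + n * q)) \<otimes>\<^bsub>G\<^esub> x0_pow (- n))"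
    by (simp add: y y_at_def m_assoc)
  also have "X (nat (m + n * q)) \<otimes>\<^bsub>G\<^esub> X (nat (i + n * q))
      = X (nat (i + n * q)) \<otimes>\<^bsub>G\<^esub> X (nat (m + q + n * q))"
    unfolding j using i assms by (intro X_rel) simp
  also have "x0_pow n \<otimes>\<^bsub>G\<^esub> (\<dots> \<otimes>\<^bsub>G\<^esub> x0_pow (- n)) = y i \<otimes>\<^bsub>G\<^esub> y (m + q)"
    by (simp add: y y_at_def m_assoc)
  finally show ?thesis .
qed

section \<open>Values of words in the y-letters\<close>

definition y_letter :: "int \<times> bool \<Rightarrow> nat gword set" where
  "y_letter = (\<lambda>(m, e). if e then y m else inv\<^bsub>G\<^esub> (y m))"

lemma y_letter_closed [simp]: "y_letter x \<in> carrier G"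
  by (simp add: y_letter_def split: prod.split)

abbreviation y_value :: "int gword \<Rightarrow> nat gword set" where
  "y_value \<equiv> word_value G y"

lemma y_value_Cons: "y_value (x # v) = y_letter x \<otimes>\<^bsub>G\<^esub> y_value v"
  by (cases x) (simp add: y_letter_def)

lemma x0_pow_y_letter: "x0_pow c \<otimes>\<^bsub>G\<^esub> y_letter (m, e) = y_letter (m - c * q, e) \<otimes>\<^bsub>G\<^esub> x0_pow c"
proof (cases e)
  case False
  then show ?thesis
    using inv_comm_right[of "y (m - c * q)" "x0_pow c" "y m"] x0_pow_y[of c m] by (simp add: y_letter_def)
qed (simp add: y_letter_def x0_pow_y)

lemma x0_pow_y_value: "x0_pow c \<otimes>\<^bsub>G\<^esub> y_value v = y_value (shift (- (c * q)) v) \<otimes>\<^bsub>G\<^esub> x0_pow c"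
proof (induction v)
  case (Cons x v)
  obtain m e where x: "x = (m, e)" by (cases x)
  have "x0_pow c \<otimes>\<^bsub>G\<^esub> y_value (x # v) = x0_pow c \<otimes>\<^bsub>G\<^esub> y_letter (m, e) \<otimes>\<^bsub>G\<^esub> y_value v"
    by (simp add: y_value_Cons x m_assoc del: word_value_Cons)
  also have "\<dots> = y_letter (m - c * q, e) \<otimes>\<^bsub>G\<^esub> (x0_pow c \<otimes>\<^bsub>G\<^esub> y_value v)"
    by (simp add: x0_pow_y_letter m_assoc)
  also have "\<dots> = y_value (shift (- (c * q)) (x # v)) \<otimes>\<^bsub>G\<^esub> x0_pow c"
    by (simp add: Cons x y_value_Cons m_assoc del: word_value_Cons)
  finally show ?case .
qed simp

text \<open>For a positive moving letter and \<open>d\<close> false, y_{m-q} y_i = y_i y_m is solved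
  for the product of y_m and y_i^-1. Inverting the moving letter gives the remaining cases.\<close>

lemma y_letter_swap:
  assumes "\<not> admissible (m, e) (i, d)" "\<not> (m = i \<and> d \<noteq> e)"
  shows "y_letter (m, e) \<otimes>\<^bsub>G\<^esub> y_letter (i, d) = y_letter (i, d) \<otimes>\<^bsub>G\<^esub> y_letter (m + jump d, e)"
proof -
  have "y m \<otimes>\<^bsub>G\<^esub> y_letter (i, d) = y_letter (i, d) \<otimes>\<^bsub>G\<^esub> y (m + jump d)"
  proof (cases d)
    case True
    then show ?thesis using swap_less[OF assms] by (simp add: y_letter_def y_rel)
  next
    case False
    then show ?thesis using swap_less[OF assms] y_rel[of i "m - q"]
      inv_comm_left[of "y (m - q)" "y i" "y m"] by (simp add: y_letter_def)
  qed
  then show ?thesis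
    using inv_comm_right[of "y m" "y_letter (i, d)" "y (m + jump d)"] by (cases e) (simp_all add: y_letter_def)
qed

lemma y_value_push: "y_value (push x v) = y_letter x \<otimes>\<^bsub>G\<^esub> y_value v"
proof (induction x v rule: push.induct)
  case (1 m e)
  then show ?case by (simp add: y_value_Cons del: word_value_Cons)
next
  case (2 m e i d v)
  show ?case
  proof (cases m i e d rule: admissible_cases)
    case cancel
    then have "y_letter (m, e) \<otimes>\<^bsub>G\<^esub> (y_letter (i, d) \<otimes>\<^bsub>G\<^esub> y_value v) = y_value v"
      by (cases d) (simp_all add: y_letter_def m_assoc[symmetric])
    then show ?thesis using cancel by (simp add: y_value_Cons del: word_value_Cons)
  next
    case admissible
    then show ?thesis by (simp only: push_ok y_value_Cons)
  next
    case swap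
    have "y_value (push (m, e) ((i, d) # v)) = y_letter (i, d) \<otimes>\<^bsub>G\<^esub> y_letter (m + jump d, e) \<otimes>\<^bsub>G\<^esub> y_value v"
      by (simp only: push_swap[OF swap] y_value_Cons "2.IH"[OF swap(2,1)]) (simp add: m_assoc)
    also have "\<dots> = y_letter (m, e) \<otimes>\<^bsub>G\<^esub> y_value ((i, d) # v)"
      by (simp add: y_letter_swap[OF swap, symmetric] y_value_Cons m_assoc del: word_value_Cons)
    finally show ?thesis .
  qed
qed

text \<open>Hence words that move \<open>([], 0)\<close> to the same pair have the same
  value.\<close>

lemma word_value_X:
  "word_value G X w = (case foldr act w ([], 0) of (v, s) \<Rightarrow> y_value v \<otimes>\<^bsub>G\<^esub> x0_pow s)"
proof (induction w)
  case (Cons l w)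
  obtain j e where l: "l = (j, e)" by (cases l)
  obtain v s where vs: "foldr act w ([], 0) = (v, s)" by fastforce
  have IH: "word_value G X w = y_value v \<otimes>\<^bsub>G\<^esub> x0_pow s" using Cons vs by simp
  show ?case
  proof (cases "j = 0")
    case True
    define c :: int where "c = (if e then 1 else - 1)"
    have "word_value G X (l # w) = x0_pow c \<otimes>\<^bsub>G\<^esub> y_value v \<otimes>\<^bsub>G\<^esub> x0_pow s"
      using l True IH by (simp add: c_def x0_pow_1 x0_pow_minus_1 m_assoc)
    also have "\<dots> = y_value (shift (- (c * q)) v) \<otimes>\<^bsub>G\<^esub> x0_pow (s + c)"
      by (simp add: x0_pow_y_value m_assoc add.commute)
    finally show ?thesis using l True vs by (simp add: c_def)
  next
    case False
    have "y (int j) = X j" using y_eq[of "int j" 0] False by (simp add: y_at_def)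
    then have "word_value G X (l # w) = y_letter (int j, e) \<otimes>\<^bsub>G\<^esub> y_value v \<otimes>\<^bsub>G\<^esub> x0_pow s"
      using l IH by (simp add: y_letter_def m_assoc)
    then show ?thesis using l False vs by (simp add: y_value_push)
  qed
qed simp

section \<open>Existence and uniqueness of the normal form\<close>

lemma ex1_N_fin:
  assumes "g \<in> carrier G"
  shows "\<exists>!w. w \<in> N_fin p \<and> represents p w g"
proof -
  obtain u where g: "g = pres_cong (thompson_rels p) `` {u}"
    using assms by (auto simp: presented_group_def quotient_def)
  obtain v s where u: "foldr act u ([], 0) = (v, s)" by fastforce
  have v: "normal v" using normal_foldr_act[of "([], 0)" u] u by simp
  show ?thesis
  proof (intro ex1I conjI; (elim conjE)?)
    show "decode 0 v s \<in> N_fin p" using v by (rule decode_in_N_fin)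
    \<comment> \<open>The decoded word and \<open>u\<close> move \<open>([], 0)\<close> to the same
      pair, so they represent the same element.\<close>
    have "foldr act (decode 0 v s) ([], 0) = (v, s)"
      using foldr_act_eq[of "decode 0 v s"] v by (simp add: encode_decode x0_sum_decode)
    then have "word_value G X (decode 0 v s) = word_value G X u" by (simp add: word_value_X u)
    then show "represents p (decode 0 v s) g"
      by (simp only: represents_def word_value_presented_group g)
  next
    fix w assume w: "w \<in> N_fin p" "represents p w g"
    then have "pres_cong (thompson_rels p) `` {w} = pres_cong (thompson_rels p) `` {u}"
      by (simp add: represents_def word_value_presented_group g)
    then have "(w, u) \<in> pres_cong (thompson_rels p)"
      using eq_equiv_class[OF _ equiv_pres_cong] by blast
    \<comment> \<open>Congruent words act alike, so \<open>g\<close> determines the encoding and the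
      exponent sum of \<open>w\<close>, and these determine \<open>w\<close>.\<close>
    then have "foldr act w ([], 0) = (v, s)" using foldr_act_pres_cong[of w u "([], 0)"] u by simp
    then have "encode 0 w = v" "x0_sum w = s" using foldr_act_eq[OF N_fin_normal[OF w(1)]] by simp_all
    then show "w = decode 0 v s" using N_fin_decode[OF w(1)] by simp
  qed
qed

end

theorem theorem5p4:
  fixes p :: nat
  assumes "p \<ge> 2"
  shows "(\<forall>g \<in> carrier (thompson_F p). \<exists>!w. w \<in> N_fin p \<and> represents p w g)
    \<and> regular_language (alphabet p) (N_fin p)"
proof -
  interpret generalized_thompson p
    by unfold_locales (rule assms)
  show ?thesis
    using ex1_N_fin regular_N_fin by blast
qed

end
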